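(* Suppose that for some $\beta>0$, $$p^{\beta},\ q^{\beta},\ \ln p\in\mathbb{L}_1(Q)\quad\text{for all }P\in\mathcal{P},\ Q\in\mathcal{P}^{+}.$$ For $\alpha>0$, $P\in\mathcal{P}$, $Q\in\mathcal{P}^+$ define $$\mathfrak{R}_{\alpha}(P,Q)=\frac{1}{1+\alpha}\ln\left(\int p^{\alpha}\,\mathrm{d}P\right)+\frac{1}{\alpha(1+\alpha)}\ln\left(\int q^{\alpha}\,\mathrm{d}Q\right)-\frac1\alpha\ln\left(\int p^{\alpha}\,\mathrm{d}Q\right).$$ Then for all $0<\alpha<\beta$, $\mathfrak{R}_{\alpha}$ is a pseudodistance on $\mathcal{P}\otimes\mathcal{P}^{+}$, decomposable in the sense $$\mathfrak{R}_{\alpha}(P,Q)=\mathfrak{R}_{\alpha}^{0}(P)+\mathfrak{R}_{\alpha}^{1}(Q)-\frac1\alpha\ln\left(\int p^{\alpha}\,\mathrm{d}Q\right),$$ where $$\mathfrak{R}_{\alpha}^{0}(P)=\frac{1}{1+\alpha}\ln\left(\int p^{\alpha}\,\mathrm{d}P\right)\quad\text{and}\quad\mathfrak{R}_{\alpha}^{1}(Q)=\frac{1}{\alpha(1+\alpha)}\ln\left(\int q^{\alpha}\,\mathrm{d}Q\right),$$ and, for all $P\in\mathcal{P}$, $Q\in\mathcal{P}^{+}$, the limit relation $$\mathfrak{R}_{\alpha}(P,Q)\to\mathfrak{R}_0(P,Q):=\int\ln q\,\mathrm{d}Q-\int\ln p\,\mathrm{d}Q\quad\text{for }\alpha\downarrow0$$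 holds.
   Context: $\mathcal{P}=\{P_\theta:\theta\in\Theta\}$ is a parametric family of probability measures on $(\mathbb{R}^d,\mathcal{B}(\mathbb{R}^d))$ with Euclidean parameter space $\Theta$; all $P_\theta$ share the same support, each $P_\theta$ has a density $p_\theta$ with respect to Lebesgue measure $\lambda$, and the parametrization is identifiable ($P_\theta=P_{\tilde\theta}$ only if $\theta=\tilde\theta$). $\mathcal{P}_0$ is a further family of probability measures on $\mathbb{R}^d$, and $\mathcal{P}^{+}=\mathcal{P}\cup\mathcal{P}_0$. The lower-case letters $p$ and $q$ denote the densities of $P\in\mathcal{P}$ and $Q\in\mathcal{P}^{+}$ with respect to $\lambda$ (all $Q\in\mathcal{P}^{+}$ are taken to have densities here). $\mathbb{L}_1(Q)=\{f:\mathbb{R}^d\to\mathbb{R}\text{ such that }\int|f|\,\mathrm{d}Q<\infty\}$. Pseudodistance on $\mathcal{P}\otimes\mathcal{P}^{+}$: a map $\mathfrak{D}$ assigning a real number to each pair $(P_\theta,Q)$, $P_\theta\in\mathcal{P}$, $Q\in\mathcal{P}^{+}$, such that $\mathfrak{D}(P_\theta,Q)\ge0$ for all $\theta\in\Theta$, $Q\in\mathcal{P}^{+}$, and $\mathfrak{D}(P_\theta,P_{\tilde\theta})=0$ if and only if $\theta=\tilde\theta$. *)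

theory Defs
  imports "HOL-Probability.Probability"
begin

definition borel_prob :: "'a::euclidean_space measure \<Rightarrow> bool" where
  "borel_prob M \<longleftrightarrow> prob_space M \<and> sets M = sets borel"

definition has_lebesgue_density :: "'a::euclidean_space measure \<Rightarrow> bool" where
  "has_lebesgue_density M \<longleftrightarrow> (\<exists>f \<in> borel_measurable lborel. M = density lborel f)"

text \<open>
  A version of the density of \<open>M\<close>, chosen by \<^const>\<open>RN_deriv\<close>. It may take the
  junk value 0 on a Lebesgue null set (where the ennreal-valued density is infinite);
  none of the integrals below depends on the version.
\<close>
definition lden :: "'a::euclidean_space measure \<Rightarrow> 'a \<Rightarrow> real" where
  "lden M x = enn2real (RN_deriv lborel M x)"

definition measure_support :: "'a::topological_space measure \<Rightarrow> 'a set" where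
  "measure_support M = {x. \<forall>U. open U \<longrightarrow> x \<in> U \<longrightarrow> 0 < emeasure M U}"

definition parametric_family :: "'t set \<Rightarrow> ('t \<Rightarrow> 'a::euclidean_space measure) \<Rightarrow> bool" where
  "parametric_family \<Theta> P \<longleftrightarrow>
     (\<forall>\<theta>\<in>\<Theta>. borel_prob (P \<theta>) \<and> has_lebesgue_density (P \<theta>)) \<and>
     (\<forall>\<theta>\<in>\<Theta>. \<forall>\<theta>'\<in>\<Theta>. measure_support (P \<theta>) = measure_support (P \<theta>')) \<and>
     (\<forall>\<theta>\<in>\<Theta>. \<forall>\<theta>'\<in>\<Theta>. P \<theta> = P \<theta>' \<longrightarrow> \<theta> = \<theta>')"

definition L1 :: "'a measure \<Rightarrow> ('a \<Rightarrow> real) set" where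
  "L1 Q = {f. integrable Q f}"

text \<open>
  Membership of \<open>ln p\<close> in \<open>L1 Q\<close>. Since \<open>ln 0 = 0\<close> in HOL while mathematically
  \<open>ln 0 = -\<infinity>\<close>, the fact that \<open>ln p\<close> is finite almost everywhere has to be
  required separately.
\<close>
definition ln_in_L1 :: "'a measure \<Rightarrow> ('a \<Rightarrow> real) \<Rightarrow> bool" where
  "ln_in_L1 Q p \<longleftrightarrow> (AE x in Q. 0 < p x) \<and> (\<lambda>x. ln (p x)) \<in> L1 Q"

text \<open>
  \<open>Pplus\<close> is meant to contain \<open>P ` \<Theta>\<close>.
\<close>
definition pseudodistance ::
  "'t set \<Rightarrow> ('t \<Rightarrow> 'a measure) \<Rightarrow> 'a measure set \<Rightarrow> ('a measure \<Rightarrow> 'a measure \<Rightarrow> real) \<Rightarrow> bool" where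
  "pseudodistance \<Theta> P Pplus D \<longleftrightarrow>
     (\<forall>\<theta>\<in>\<Theta>. \<forall>Q\<in>Pplus. 0 \<le> D (P \<theta>) Q) \<and>
     (\<forall>\<theta>\<in>\<Theta>. \<forall>\<theta>'\<in>\<Theta>. D (P \<theta>) (P \<theta>') = 0 \<longleftrightarrow> \<theta> = \<theta>')"

definition renyi :: "real \<Rightarrow> 'a::euclidean_space measure \<Rightarrow> 'a measure \<Rightarrow> real" where
  "renyi \<alpha> P Q =
     1 / (1 + \<alpha>) * ln (\<integral>x. lden P x powr \<alpha> \<partial>P)
     + 1 / (\<alpha> * (1 + \<alpha>)) * ln (\<integral>x. lden Q x powr \<alpha> \<partial>Q)
     - 1 / \<alpha> * ln (\<integral>x. lden P x powr \<alpha> \<partial>Q)"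

definition renyi_part0 :: "real \<Rightarrow> 'a::euclidean_space measure \<Rightarrow> real" where
  "renyi_part0 \<alpha> P = 1 / (1 + \<alpha>) * ln (\<integral>x. lden P x powr \<alpha> \<partial>P)"

definition renyi_part1 :: "real \<Rightarrow> 'a::euclidean_space measure \<Rightarrow> real" where
  "renyi_part1 \<alpha> Q = 1 / (\<alpha> * (1 + \<alpha>)) * ln (\<integral>x. lden Q x powr \<alpha> \<partial>Q)"

definition renyi_zero :: "'a::euclidean_space measure \<Rightarrow> 'a measure \<Rightarrow> real" where
  "renyi_zero P Q = (\<integral>x. ln (lden Q x) \<partial>Q) - (\<integral>x. ln (lden P x) \<partial>Q)"

text \<open>
  HOL gives junk values to \<open>ln\<close> at nonpositive arguments and to integrals of
  nonintegrable functions. The next two predicates say that the values of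
  \<^const>\<open>renyi\<close> and \<^const>\<open>renyi_zero\<close> are genuine real numbers.
\<close>
definition renyi_well_defined :: "real \<Rightarrow> 'a::euclidean_space measure \<Rightarrow> 'a measure \<Rightarrow> bool" where
  "renyi_well_defined \<alpha> P Q \<longleftrightarrow>
     (\<lambda>x. lden P x powr \<alpha>) \<in> L1 P \<and> 0 < (\<integral>x. lden P x powr \<alpha> \<partial>P) \<and>
     (\<lambda>x. lden Q x powr \<alpha>) \<in> L1 Q \<and> 0 < (\<integral>x. lden Q x powr \<alpha> \<partial>Q) \<and>
     (\<lambda>x. lden P x powr \<alpha>) \<in> L1 Q \<and> 0 < (\<integral>x. lden P x powr \<alpha> \<partial>Q)"

definition renyi_zero_well_defined :: "'a::euclidean_space measure \<Rightarrow> 'a measure \<Rightarrow> bool" where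
  "renyi_zero_well_defined P Q \<longleftrightarrow> ln_in_L1 Q (lden Q) \<and> ln_in_L1 Q (lden P)"

end

theory Submission imports Defs begin

text \<open>
  Put \<open>A = \<integral> p\<^sup>1\<^sup>+\<^sup>\<alpha> d\<lambda>\<close>, \<open>B = \<integral> q\<^sup>1\<^sup>+\<^sup>\<alpha> d\<lambda>\<close> and \<open>C = \<integral> p\<^sup>\<alpha> q d\<lambda>\<close>. These are the three integrals in
  \<open>renyi \<alpha> P Q\<close>, rewritten over Lebesgue measure, and \<open>\<alpha>\<close> times the Renyi expression is
  \<open>\<alpha>/(1+\<alpha>) ln A + 1/(1+\<alpha>) ln B - ln C\<close>: the logarithmic gap in Hoelder's inequality for \<open>p\<^sup>\<alpha>\<close> and \<open>q\<close>
  with exponents \<open>(1+\<alpha>)/\<alpha>\<close> and \<open>1+\<alpha>\<close>. Hence it is nonnegative, and it vanishes only if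
  \<open>p\<^sup>1\<^sup>+\<^sup>\<alpha>\<close> and \<open>q\<^sup>1\<^sup>+\<^sup>\<alpha>\<close> are proportional almost everywhere. Then \<open>p\<close> and \<open>q\<close> are proportional, and
  both have mass 1, so \<open>P = Q\<close>; identifiability turns this into equality of the parameters
  (\<open>log_Hoelder\<close>, \<open>proportional_powers_imp_eq_AE\<close>, \<open>renyi_nonneg_and_definite\<close>).

  For the limit, let \<open>F \<alpha> = \<integral> f\<^sup>\<alpha> dQ\<close> with \<open>f\<close> one of the densities. For fixed \<open>t > 0\<close> the quotient
  \<open>(t\<^sup>\<alpha> - 1)/\<alpha>\<close> decreases to \<open>ln t\<close> as \<open>\<alpha>\<close> decreases to 0, so it lies between \<open>ln t\<close> and its value
  at \<open>\<beta>\<close>. Dominated convergence gives \<open>(F \<alpha> - 1)/\<alpha> \<longlongrightarrow> \<integral> ln f dQ\<close>, and since \<open>F \<alpha> \<longlongrightarrow> 1\<close> the same limit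
  holds for \<open>ln (F \<alpha>)/\<alpha>\<close> (\<open>tendsto_ln_moment\<close>). The \<open>P\<close>-moment of \<open>p\<close> enters \<open>renyi\<close> without
  a factor \<open>1/\<alpha>\<close> and disappears.

  The limit needs \<open>ln q \<in> L1 Q\<close> even for \<open>Q\<close> outside the family, where it has to be derived
  (\<open>ln_lden_integrable\<close>): \<open>ln q\<close> is bounded above by \<open>q\<^sup>\<beta>/\<beta>\<close> and below by \<open>ln p - p/q\<close>, and
  \<open>\<integral> p/q dQ \<le> \<integral> p d\<lambda> = 1\<close>.
\<close>

section \<open>The weighted arithmetic-geometric mean inequality\<close>

text \<open>
  With \<open>m\<close> the weighted arithmetic mean, the inequality is the average of the two tangent
  inequalities \<open>ln (a/m) \<le> a/m - 1\<close> and \<open>ln (b/m) \<le> b/m - 1\<close>, whose right-hand sides average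
  to 0. Equality therefore forces equality in both, that is \<open>a = m = b\<close>.
\<close>

lemma weighted_am_gm_strict:
  fixes a b w :: real
  assumes w: "0 < w" "w < 1" and ab: "0 < a" "0 < b"
    and eq: "a powr w * b powr (1 - w) = w * a + (1 - w) * b"
  shows "a = b"
proof -
  define m where "m = w * a + (1 - w) * b"
  have m: "0 < m"
    using w ab by (simp add: m_def add_pos_pos)
  have "w * ln a + (1 - w) * ln b = ln m"
    using ab by (simp add: m_def flip: eq) (simp add: ln_mult ln_powr)
  then have "w * ln (a / m) + (1 - w) * ln (b / m) = 0"
    using ab m by (simp add: ln_div algebra_simps)
  moreover have "w * (a / m - 1) + (1 - w) * (b / m - 1) = 0"
    using m by (simp add: m_def field_simps)
  moreover have la: "ln (a / m) \<le> a / m - 1" and lb: "ln (b / m) \<le> b / m - 1"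
    using ab m by (auto intro!: ln_le_minus_one simp del: ln_div)
  moreover have "w * ln (a / m) \<le> w * (a / m - 1)" "(1 - w) * ln (b / m) \<le> (1 - w) * (b / m - 1)"
    using w la lb by (auto intro!: mult_left_mono simp del: ln_div)
  ultimately have "w * ln (a / m) = w * (a / m - 1)" "(1 - w) * ln (b / m) = (1 - w) * (b / m - 1)"
    by linarith+
  then have "ln (a / m) = a / m - 1" "ln (b / m) = b / m - 1"
    using w by auto
  then have "a / m = 1" "b / m = 1"
    using ab m ln_eq_minus_one[of "a / m"] ln_eq_minus_one[of "b / m"] by (simp_all del: ln_div)
  then show ?thesis
    using m by simp
qed

lemma weighted_am_gm:
  fixes a b w :: real
  assumes w: "0 < w" "w < 1" and ab: "0 \<le> a" "0 \<le> b"
  shows "a powr w * b powr (1 - w) \<le> w * a + (1 - w) * b"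
    and "a powr w * b powr (1 - w) = w * a + (1 - w) * b \<Longrightarrow> a = b"
proof -
  show "a powr w * b powr (1 - w) \<le> w * a + (1 - w) * b"
  proof (cases "a = 0 \<or> b = 0")
    case False
    then show ?thesis
      using Youngs_inequality_0[of w "1 - w" a b] w ab by simp
  qed (use w ab in auto)
  show "a = b" if "a powr w * b powr (1 - w) = w * a + (1 - w) * b"
  proof (cases "a = 0 \<or> b = 0")
    case True
    then show ?thesis
      using that w by auto
  qed (use that w ab weighted_am_gm_strict in auto)
qed

section \<open>The logarithmic Hoelder inequality and its equality case\<close>

text \<open>
  After \<open>f\<^sup>1\<^sup>+\<^sup>\<alpha>\<close> and \<open>g\<^sup>1\<^sup>+\<^sup>\<alpha>\<close> are normalised to mass 1, the weighted mean inequality holds pointwise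
  with weight \<open>\<alpha>/(1+\<alpha>)\<close>. Its defect is a nonnegative function with integral
  \<open>1 - C / (A\<^sup>w B\<^sup>1\<^sup>-\<^sup>w)\<close>; if this integral is 0 then the defect vanishes almost everywhere, and the
  equality case of the pointwise inequality applies.
\<close>

lemma log_Hoelder:
  fixes M :: "'a measure" and f g :: "'a \<Rightarrow> real" and \<alpha> :: real
  defines "A \<equiv> \<integral>x. f x powr (1 + \<alpha>) \<partial>M" and "B \<equiv> \<integral>x. g x powr (1 + \<alpha>) \<partial>M"
    and "C \<equiv> \<integral>x. f x powr \<alpha> * g x \<partial>M"
  assumes \<alpha>: "0 < \<alpha>"
    and nonneg: "\<And>x. 0 \<le> f x" "\<And>x. 0 \<le> g x"
    and int: "integrable M (\<lambda>x. f x powr (1 + \<alpha>))" "integrable M (\<lambda>x. g x powr (1 + \<alpha>))"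
      "integrable M (\<lambda>x. f x powr \<alpha> * g x)"
    and pos: "0 < A" "0 < B" "0 < C"
  shows "ln C \<le> \<alpha> / (1 + \<alpha>) * ln A + 1 / (1 + \<alpha>) * ln B"
    and "ln C = \<alpha> / (1 + \<alpha>) * ln A + 1 / (1 + \<alpha>) * ln B \<Longrightarrow>
      AE x in M. f x powr (1 + \<alpha>) / A = g x powr (1 + \<alpha>) / B"
proof -
  define w where "w = \<alpha> / (1 + \<alpha>)"
  have w: "0 < w" "w < 1" and w': "1 - w = 1 / (1 + \<alpha>)"
    using \<alpha> by (auto simp: w_def field_simps)
  have exps: "(1 + \<alpha>) * w = \<alpha>" "(1 + \<alpha>) * (1 - w) = 1"
    using \<alpha> unfolding w' by (auto simp: w_def)
  define K where "K = A powr w * B powr (1 - w)"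
  have K: "0 < K" "ln K = w * ln A + (1 - w) * ln B"
    using pos by (auto simp: K_def ln_mult ln_powr)
  define a b where "a = (\<lambda>x. f x powr (1 + \<alpha>) / A)" and "b = (\<lambda>x. g x powr (1 + \<alpha>) / B)"
  have ab: "0 \<le> a x" "0 \<le> b x" for x
    using pos by (auto simp: a_def b_def)
  have prod: "a x powr w * b x powr (1 - w) = f x powr \<alpha> * g x / K" for x
    using nonneg[of x] pos
    by (simp add: a_def b_def K_def powr_divide powr_powr exps)
  let ?gap = "\<lambda>x. w * a x + (1 - w) * b x - f x powr \<alpha> * g x / K"
  have gap_nonneg: "0 \<le> ?gap x" for x
    using weighted_am_gm(1)[OF w ab[of x]] by (simp add: prod)
  have gap_int: "integrable M ?gap"
    using int by (auto simp: a_def b_def)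
  have gap: "(\<integral>x. ?gap x \<partial>M) = 1 - C / K"
    using int pos by (simp add: a_def b_def A_def B_def C_def)
  have "0 \<le> 1 - C / K"
    unfolding gap[symmetric] using gap_nonneg by simp
  then have "C \<le> K"
    using K by (simp add: field_simps)
  then show "ln C \<le> \<alpha> / (1 + \<alpha>) * ln A + 1 / (1 + \<alpha>) * ln B"
    using K pos ln_le_cancel_iff[of C K] by (simp flip: w_def w')
  assume "ln C = \<alpha> / (1 + \<alpha>) * ln A + 1 / (1 + \<alpha>) * ln B"
  then have "ln C = ln K"
    unfolding K w_def[symmetric] w'[symmetric] .
  then have "C = K"
    using K(1) pos by simp
  then have "AE x in M. ?gap x = 0"
    using integral_nonneg_eq_0_iff_AE[OF gap_int] gap gap_nonneg K by simp
  then show "AE x in M. f x powr (1 + \<alpha>) / A = g x powr (1 + \<alpha>) / B"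
  proof eventually_elim
    case (elim x)
    then have "a x = b x"
      by (intro weighted_am_gm(2)[OF w ab[of x]]) (simp add: prod)
    then show ?case
      by (simp add: a_def b_def)
  qed
qed

lemma proportional_powers_imp_eq_AE:
  fixes f g :: "'a \<Rightarrow> real"
  assumes r: "0 < r" and pos: "0 < A" "0 < B"
    and nonneg: "\<And>x. 0 \<le> f x" "\<And>x. 0 \<le> g x"
    and meas: "f \<in> borel_measurable M" "g \<in> borel_measurable M"
    and mass: "(\<integral>x. f x \<partial>M) = 1" "(\<integral>x. g x \<partial>M) = 1"
    and ratio: "AE x in M. f x powr r / A = g x powr r / B"
  shows "AE x in M. f x = g x"
proof -
  define c where "c = (A / B) powr (1 / r)"
  have fg: "AE x in M. f x = c * g x"
    using ratio
  proof eventually_elim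
    case (elim x)
    have "f x = (f x powr r) powr (1 / r)"
      using r nonneg by (simp add: powr_powr)
    also have "f x powr r = A / B * g x powr r"
      using elim pos by (simp add: field_simps)
    also have "\<dots> powr (1 / r) = c * g x"
      using r nonneg pos by (subst powr_mult) (simp_all add: c_def powr_powr)
    finally show ?case .
  qed
  have "(\<integral>x. f x \<partial>M) = (\<integral>x. c * g x \<partial>M)"
    using fg meas by (intro integral_cong_AE) auto
  then have "c = 1"
    using mass by simp
  then show ?thesis
    using fg by simp
qed

section \<open>Power moments of small exponent\<close>

lemma (in finite_measure) integrable_powr_smaller:
  fixes f :: "'a \<Rightarrow> real"
  assumes f: "f \<in> borel_measurable M" and int: "integrable M (\<lambda>x. f x powr \<beta>)" and "0 < \<alpha>" "\<alpha> < \<beta>"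
  shows "integrable M (\<lambda>x. f x powr \<alpha>)"
proof (rule Bochner_Integration.integrable_bound)
  show "integrable M (\<lambda>x. 1 + f x powr \<beta>)"
    using int by simp
  show "(\<lambda>x. f x powr \<alpha>) \<in> borel_measurable M"
    using f by simp
  have "t powr \<alpha> \<le> 1 + t powr \<beta>" for t :: real
  proof -
    have "t powr \<alpha> \<le> \<alpha> / \<beta> * t powr \<beta> + (1 - \<alpha> / \<beta>)"
      using weighted_am_gm(1)[of "\<alpha> / \<beta>" "t powr \<beta>" 1] assms(3,4) by (simp add: powr_powr)
    also have "\<dots> \<le> 1 * t powr \<beta> + 1"
      using assms(3,4) by (intro add_mono mult_right_mono) auto
    finally show ?thesis
      by simp
  qed
  then show "AE x in M. norm (f x powr \<alpha>) \<le> norm (1 + f x powr \<beta>)"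
    by (simp add: abs_of_nonneg)
qed

lemma (in prob_space) integral_pos_AE:
  fixes f :: "'a \<Rightarrow> real"
  assumes "integrable M f" and pos: "AE x in M. 0 < f x"
  shows "0 < (\<integral>x. f x \<partial>M)"
proof -
  have nn: "AE x in M. 0 \<le> f x"
    using pos by eventually_elim simp
  have "(\<integral>x. f x \<partial>M) \<noteq> 0"
  proof
    assume "(\<integral>x. f x \<partial>M) = 0"
    then have "AE x in M. f x = 0"
      using integral_nonneg_eq_0_iff_AE[OF assms(1) nn] by simp
    with pos have "AE x in M. False"
      by eventually_elim simp
    then show False
      by simp
  qed
  then show ?thesis
    using integral_nonneg_AE[OF nn] by simp
qed

text \<open>
  The upper bound is concavity of \<open>s \<mapsto> s\<^sup>\<alpha>\<^sup>/\<^sup>\<beta>\<close> at \<open>s = t\<^sup>\<beta>\<close>, in the form of the weighted mean inequality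
  of \<open>t\<^sup>\<beta>\<close> and 1. Together the two bounds give a dominating function that does not depend on \<open>\<alpha>\<close>.
\<close>
lemma powr_difference_quotient_bounds:
  fixes t :: real
  assumes t: "0 < t" and \<alpha>: "0 < \<alpha>" "\<alpha> < \<beta>"
  shows "ln t \<le> (t powr \<alpha> - 1) / \<alpha>" and "(t powr \<alpha> - 1) / \<alpha> \<le> (t powr \<beta> - 1) / \<beta>"
proof -
  have "1 + \<alpha> * ln t \<le> t powr \<alpha>"
    using exp_ge_add_one_self[of "\<alpha> * ln t"] t by (simp add: powr_def)
  then show "ln t \<le> (t powr \<alpha> - 1) / \<alpha>"
    using \<alpha> by (simp add: field_simps)
  have "t powr \<alpha> \<le> \<alpha> / \<beta> * t powr \<beta> + (1 - \<alpha> / \<beta>)"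
    using weighted_am_gm(1)[of "\<alpha> / \<beta>" "t powr \<beta>" 1] \<alpha> by (simp add: powr_powr)
  then have "(t powr \<alpha> - 1) / \<alpha> \<le> (\<alpha> / \<beta> * (t powr \<beta> - 1)) / \<alpha>"
    using \<alpha> by (intro divide_right_mono) (auto simp: algebra_simps)
  then show "(t powr \<alpha> - 1) / \<alpha> \<le> (t powr \<beta> - 1) / \<beta>"
    using \<alpha> by simp
qed

lemma tendsto_powr_difference_quotient:
  fixes t :: real
  assumes "0 < t"
  shows "((\<lambda>\<alpha>. (t powr \<alpha> - 1) / \<alpha>) \<longlongrightarrow> ln t) (at_right 0)"
proof -
  have "((\<lambda>\<alpha>. t powr \<alpha>) has_real_derivative ln t) (at 0)"
    using assms by (auto intro!: derivative_eq_intros)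
  then have "((\<lambda>\<alpha>. (t powr \<alpha> - 1) / \<alpha>) \<longlongrightarrow> ln t) (at 0)"
    using assms by (simp add: DERIV_def)
  then show ?thesis
    by (rule filterlim_mono) (auto simp: at_le)
qed

lemma (in prob_space) tendsto_moment_difference_quotient:
  fixes f :: "'a \<Rightarrow> real"
  assumes f: "f \<in> borel_measurable M" and pos: "AE x in M. 0 < f x"
    and ln_f: "integrable M (\<lambda>x. ln (f x))" and \<beta>: "0 < \<beta>" and int: "integrable M (\<lambda>x. f x powr \<beta>)"
  shows "((\<lambda>\<alpha>. ((\<integral>x. f x powr \<alpha> \<partial>M) - 1) / \<alpha>) \<longlongrightarrow> (\<integral>x. ln (f x) \<partial>M)) (at_right 0)"
proof (rule tendsto_at_right_sequentially[OF \<beta>])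
  fix S :: "nat \<Rightarrow> real"
  assume S: "\<And>n. 0 < S n" "\<And>n. S n < \<beta>" "S \<longlonglongrightarrow> 0"
  have S_right: "filterlim S (at_right 0) sequentially"
    using S by (simp add: filterlim_at less_imp_neq[symmetric])
  have "(\<lambda>n. \<integral>x. (f x powr S n - 1) / S n \<partial>M) \<longlonglongrightarrow> (\<integral>x. ln (f x) \<partial>M)"
  proof (rule integral_dominated_convergence)
    show "integrable M (\<lambda>x. \<bar>ln (f x)\<bar> + \<bar>(f x powr \<beta> - 1) / \<beta>\<bar>)"
      using ln_f int by simp
    show "AE x in M. (\<lambda>n. (f x powr S n - 1) / S n) \<longlonglongrightarrow> ln (f x)"
      using pos
    proof eventually_elim
      case (elim x)
      then show ?case
        by (rule filterlim_compose[OF tendsto_powr_difference_quotient S_right])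
    qed
    show "AE x in M. norm ((f x powr S n - 1) / S n) \<le> \<bar>ln (f x)\<bar> + \<bar>(f x powr \<beta> - 1) / \<beta>\<bar>" for n
      using pos
    proof eventually_elim
      case (elim x)
      show ?case
        using powr_difference_quotient_bounds[OF elim S(1,2)[of n]] by (simp del: abs_divide)
    qed
  qed (use f in auto)
  moreover have "(\<integral>x. (f x powr S n - 1) / S n \<partial>M) = ((\<integral>x. f x powr S n \<partial>M) - 1) / S n" for n
    using integrable_powr_smaller[OF f int S(1,2)] by (simp add: prob_space)
  ultimately show "(\<lambda>n. ((\<integral>x. f x powr S n \<partial>M) - 1) / S n) \<longlonglongrightarrow> (\<integral>x. ln (f x) \<partial>M)"
    by (simp only:)
qed

text \<open>
  Since \<open>1 - 1/y \<le> ln y \<le> y - 1\<close>, the quotient \<open>ln (F \<alpha>) / \<alpha>\<close> is squeezed between the difference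
  quotient of \<open>F\<close> at 0 and the same quotient divided by \<open>F \<alpha>\<close>, which tends to 1.
\<close>
lemma (in prob_space) tendsto_ln_moment:
  fixes f :: "'a \<Rightarrow> real"
  assumes f: "f \<in> borel_measurable M" and pos: "AE x in M. 0 < f x"
    and ln_f: "integrable M (\<lambda>x. ln (f x))" and \<beta>: "0 < \<beta>" and int: "integrable M (\<lambda>x. f x powr \<beta>)"
  shows "((\<lambda>\<alpha>. ln (\<integral>x. f x powr \<alpha> \<partial>M) / \<alpha>) \<longlongrightarrow> (\<integral>x. ln (f x) \<partial>M)) (at_right 0)"
    and "((\<lambda>\<alpha>. ln (\<integral>x. f x powr \<alpha> \<partial>M)) \<longlongrightarrow> 0) (at_right 0)"
proof -
  define F where "F = (\<lambda>\<alpha>. \<integral>x. f x powr \<alpha> \<partial>M)"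
  have small: "\<forall>\<^sub>F \<alpha> in at_right (0::real). 0 < \<alpha> \<and> \<alpha> < \<beta>"
    using \<beta> by (auto simp: eventually_at_right_field)
  have id: "((\<lambda>\<alpha>::real. \<alpha>) \<longlongrightarrow> 0) (at_right 0)"
    by (rule tendsto_ident_at)
  have F_pos: "0 < F \<alpha>" if "0 < \<alpha>" "\<alpha> < \<beta>" for \<alpha>
    unfolding F_def
    using pos by (intro integral_pos_AE integrable_powr_smaller[OF f int that]) auto
  have quot: "((\<lambda>\<alpha>. (F \<alpha> - 1) / \<alpha>) \<longlongrightarrow> (\<integral>x. ln (f x) \<partial>M)) (at_right 0)"
    unfolding F_def by (rule tendsto_moment_difference_quotient[OF assms])
  have "((\<lambda>\<alpha>. (F \<alpha> - 1) / \<alpha> * \<alpha> + 1) \<longlongrightarrow> (\<integral>x. ln (f x) \<partial>M) * 0 + 1) (at_right 0)"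
    by (intro tendsto_intros quot id)
  then have "((\<lambda>\<alpha>. (F \<alpha> - 1) / \<alpha> * \<alpha> + 1) \<longlongrightarrow> 1) (at_right 0)"
    by simp
  then have F1: "(F \<longlongrightarrow> 1) (at_right 0)"
    by (rule Lim_transform_eventually) (use small in eventually_elim, simp)
  have lower: "((\<lambda>\<alpha>. (F \<alpha> - 1) / \<alpha> / F \<alpha>) \<longlongrightarrow> (\<integral>x. ln (f x) \<partial>M) / 1) (at_right 0)"
    by (intro tendsto_intros quot F1) simp
  have "((\<lambda>\<alpha>. ln (F \<alpha>) / \<alpha>) \<longlongrightarrow> (\<integral>x. ln (f x) \<partial>M)) (at_right 0)"
  proof (rule tendsto_sandwich)
    show "\<forall>\<^sub>F \<alpha> in at_right 0. (F \<alpha> - 1) / \<alpha> / F \<alpha> \<le> ln (F \<alpha>) / \<alpha>"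
      using small
    proof eventually_elim
      case (elim \<alpha>)
      have "1 - 1 / F \<alpha> \<le> ln (F \<alpha>)"
        using ln_le_minus_one[of "1 / F \<alpha>"] F_pos[of \<alpha>] elim by (simp add: ln_div split: if_splits)
      then have "(1 - 1 / F \<alpha>) / \<alpha> \<le> ln (F \<alpha>) / \<alpha>"
        using elim by (intro divide_right_mono) auto
      moreover have "(F \<alpha> - 1) / \<alpha> / F \<alpha> = (1 - 1 / F \<alpha>) / \<alpha>"
        using F_pos[of \<alpha>] elim by (simp add: field_simps)
      ultimately show ?case
        by simp
    qed
    show "\<forall>\<^sub>F \<alpha> in at_right 0. ln (F \<alpha>) / \<alpha> \<le> (F \<alpha> - 1) / \<alpha>"
      using small by eventually_elim (auto intro!: divide_right_mono ln_le_minus_one F_pos)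
  qed (use lower quot in auto)
  then show "((\<lambda>\<alpha>. ln (\<integral>x. f x powr \<alpha> \<partial>M) / \<alpha>) \<longlongrightarrow> (\<integral>x. ln (f x) \<partial>M)) (at_right 0)"
    by (simp add: F_def)
  have "((\<lambda>\<alpha>. ln (F \<alpha>)) \<longlongrightarrow> ln 1) (at_right 0)"
    by (intro tendsto_ln F1) simp
  then show "((\<lambda>\<alpha>. ln (\<integral>x. f x powr \<alpha> \<partial>M)) \<longlongrightarrow> 0) (at_right 0)"
    by (simp add: F_def)
qed

section \<open>Probability measures with a Lebesgue density\<close>

lemma lden_nonneg [simp]: "0 \<le> lden M x"
  by (simp add: lden_def)

lemma borel_measurable_lden [measurable]: "lden M \<in> borel_measurable borel"
proof -
  have "RN_deriv lborel M \<in> borel_measurable lborel"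
    by (rule borel_measurable_RN_deriv)
  then show ?thesis
    unfolding lden_def by simp
qed

context
  fixes Q :: "'a::euclidean_space measure"
  assumes prob: "borel_prob Q" and dens: "has_lebesgue_density Q"
begin

lemma borel_measurable_under [simp]: "borel_measurable Q = (borel_measurable borel :: ('a \<Rightarrow> real) set)"
  using prob by (intro measurable_cong_sets) (auto simp: borel_prob_def)

text \<open>
  A probability measure is sigma-finite, so its density is finite almost everywhere and the
  conversion to real values loses nothing.
\<close>
lemma density_lden: "density lborel (\<lambda>x. ennreal (lden Q x)) = Q"
proof -
  interpret Q: prob_space Q
    using prob by (simp add: borel_prob_def)
  obtain f where f: "f \<in> borel_measurable lborel" "density lborel f = Q"
    using dens by (auto simp: has_lebesgue_density_def)
  have RN: "density lborel (RN_deriv lborel Q) = Q"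
    using density_RN_deriv_density[OF f(1)] f(2) by simp
  have "sigma_finite_measure (density lborel (RN_deriv lborel Q))"
    unfolding RN by unfold_locales
  then have "AE x in lborel. RN_deriv lborel Q x \<noteq> \<infinity>"
    using sigma_finite_measure.sigma_finite_iff_density_finite[OF sigma_finite_lborel borel_measurable_RN_deriv] by auto
  then have "AE x in lborel. RN_deriv lborel Q x = ennreal (lden Q x)"
    by eventually_elim (simp add: lden_def less_top)
  then have "density lborel (RN_deriv lborel Q) = density lborel (\<lambda>x. ennreal (lden Q x))"
    by (intro density_cong) auto
  then show ?thesis
    using RN by simp
qed

lemma integrable_lden_iff:
  fixes f :: "'a \<Rightarrow> real"
  assumes "f \<in> borel_measurable borel"
  shows "integrable Q f \<longleftrightarrow> integrable lborel (\<lambda>x. lden Q x * f x)"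
  using integrable_density[of f lborel "lden Q"] assms by (simp add: density_lden)

lemma integral_lden:
  fixes f :: "'a \<Rightarrow> real"
  assumes "f \<in> borel_measurable borel"
  shows "(\<integral>x. f x \<partial>Q) = (\<integral>x. lden Q x * f x \<partial>lborel)"
  using integral_density[of f lborel "lden Q"] assms by (simp add: density_lden)

lemma lden_mass: "integrable lborel (lden Q)" "(\<integral>x. lden Q x \<partial>lborel) = 1"
proof -
  interpret Q: prob_space Q
    using prob by (simp add: borel_prob_def)
  show "integrable lborel (lden Q)" "(\<integral>x. lden Q x \<partial>lborel) = 1"
    using integrable_lden_iff[of "\<lambda>_. 1"] integral_lden[of "\<lambda>_. 1"] by (simp_all add: Q.prob_space)
qed

lemma AE_lden_pos: "AE x in Q. 0 < lden Q x"
proof -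
  have "AE x in density lborel (\<lambda>x. ennreal (lden Q x)). 0 < lden Q x"
    by (subst AE_density) auto
  then show ?thesis
    unfolding density_lden .
qed

text \<open>
  This is finiteness of the negative part of a relative entropy: \<open>ln (f/q) \<le> f/q - 1\<close> bounds \<open>ln q\<close>
  from below by \<open>ln f - f/q\<close>, and \<open>f/q\<close> is \<open>Q\<close>-integrable because \<open>q\<close> times it is at most \<open>f\<close>.
  The moment of order \<open>\<beta>\<close> controls \<open>ln q\<close> from above.
\<close>
lemma ln_lden_integrable:
  fixes f :: "'a \<Rightarrow> real"
  assumes f: "f \<in> borel_measurable borel" "\<And>x. 0 \<le> f x" "integrable lborel f"
    and pos: "AE x in Q. 0 < f x" and ln_f: "integrable Q (\<lambda>x. ln (f x))"
    and \<beta>: "0 < \<beta>" and int: "integrable Q (\<lambda>x. lden Q x powr \<beta>)"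
  shows "integrable Q (\<lambda>x. ln (lden Q x))"
proof (rule Bochner_Integration.integrable_bound)
  \<comment> \<open>The integrand is \<open>f\<close> where \<open>q > 0\<close> and, as division by 0 yields 0, it is 0 elsewhere.\<close>
  have "integrable lborel (\<lambda>x. lden Q x * (f x / lden Q x))"
    by (rule Bochner_Integration.integrable_bound[OF f(3)]) (use f in auto)
  then have ratio: "integrable Q (\<lambda>x. f x / lden Q x)"
    using f by (simp add: integrable_lden_iff)
  show "integrable Q (\<lambda>x. \<bar>ln (f x)\<bar> + f x / lden Q x + lden Q x powr \<beta> / \<beta>)"
    using ln_f ratio int by simp
  show "AE x in Q. norm (ln (lden Q x)) \<le> norm (\<bar>ln (f x)\<bar> + f x / lden Q x + lden Q x powr \<beta> / \<beta>)"
    using pos AE_lden_pos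
  proof eventually_elim
    case (elim x)
    have "ln (f x) - ln (lden Q x) \<le> f x / lden Q x - 1"
      using ln_le_minus_one[of "f x / lden Q x"] elim by (simp add: ln_div)
    moreover have "\<beta> * ln (lden Q x) \<le> lden Q x powr \<beta> - 1"
      using ln_le_minus_one[of "lden Q x powr \<beta>"] elim by (simp add: ln_powr)
    then have "ln (lden Q x) \<le> lden Q x powr \<beta> / \<beta>"
      using \<beta> by (simp add: field_simps)
    moreover have "0 \<le> f x / lden Q x" "0 \<le> lden Q x powr \<beta> / \<beta>"
      using elim \<beta> by auto
    ultimately show ?case
      by (simp del: zero_le_divide_iff divide_nonneg_nonneg)
  qed
qed simp

end

section \<open>The Renyi pseudodistance\<close>

lemma renyi_eq_scaled_gap:
  assumes "0 < \<alpha>"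
  shows "renyi \<alpha> P Q = (\<alpha> / (1 + \<alpha>) * ln (\<integral>x. lden P x powr \<alpha> \<partial>P)
      + 1 / (1 + \<alpha>) * ln (\<integral>x. lden Q x powr \<alpha> \<partial>Q) - ln (\<integral>x. lden P x powr \<alpha> \<partial>Q)) / \<alpha>"
  using assms by (simp add: renyi_def add_divide_distrib diff_divide_distrib)

lemma renyi_self:
  assumes "0 < \<alpha>"
  shows "renyi \<alpha> P P = 0"
proof -
  have "\<alpha> / (1 + \<alpha>) + 1 / (1 + \<alpha>) = 1"
    using assms by (simp flip: add_divide_distrib)
  then have "\<alpha> / (1 + \<alpha>) * t + 1 / (1 + \<alpha>) * t - t = 0" for t :: real
    by (simp only: mult_1 diff_self flip: distrib_right)
  then show ?thesis
    using assms by (simp add: renyi_eq_scaled_gap)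
qed

text \<open>
  Integrating against \<open>P\<close> or \<open>Q\<close> multiplies the integrand by \<open>p\<close> or \<open>q\<close>, so the three integrals are
  exactly those of the logarithmic Hoelder inequality over Lebesgue measure.
\<close>
lemma renyi_nonneg_and_definite:
  fixes P Q :: "'a::euclidean_space measure"
  assumes P: "borel_prob P" "has_lebesgue_density P" and Q: "borel_prob Q" "has_lebesgue_density Q"
    and \<alpha>: "0 < \<alpha>" and wd: "renyi_well_defined \<alpha> P Q"
  shows "0 \<le> renyi \<alpha> P Q" and "renyi \<alpha> P Q = 0 \<Longrightarrow> P = Q"
proof -
  have powr_Suc: "lden M x * lden M x powr \<alpha> = lden M x powr (1 + \<alpha>)" for M and x :: 'a
    using powr_mult_base[of "lden M x" \<alpha>] by simp
  have moments:
    "(\<integral>x. lden P x powr \<alpha> \<partial>P) = (\<integral>x. lden P x powr (1 + \<alpha>) \<partial>lborel)"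
    "(\<integral>x. lden Q x powr \<alpha> \<partial>Q) = (\<integral>x. lden Q x powr (1 + \<alpha>) \<partial>lborel)"
    "(\<integral>x. lden P x powr \<alpha> \<partial>Q) = (\<integral>x. lden P x powr \<alpha> * lden Q x \<partial>lborel)"
    using integral_lden[OF P, of "\<lambda>x. lden P x powr \<alpha>"] integral_lden[OF Q, of "\<lambda>x. lden Q x powr \<alpha>"]
      integral_lden[OF Q, of "\<lambda>x. lden P x powr \<alpha>"]
    by (simp_all add: powr_Suc mult.commute)
  have int:
    "integrable lborel (\<lambda>x. lden P x powr (1 + \<alpha>))"
    "integrable lborel (\<lambda>x. lden Q x powr (1 + \<alpha>))"
    "integrable lborel (\<lambda>x. lden P x powr \<alpha> * lden Q x)"
    using wd integrable_lden_iff[OF P, of "\<lambda>x. lden P x powr \<alpha>"]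
      integrable_lden_iff[OF Q, of "\<lambda>x. lden Q x powr \<alpha>"]
      integrable_lden_iff[OF Q, of "\<lambda>x. lden P x powr \<alpha>"]
    by (simp_all add: renyi_well_defined_def L1_def powr_Suc mult.commute)
  have pos: "0 < (\<integral>x. lden P x powr (1 + \<alpha>) \<partial>lborel)" "0 < (\<integral>x. lden Q x powr (1 + \<alpha>) \<partial>lborel)"
    "0 < (\<integral>x. lden P x powr \<alpha> * lden Q x \<partial>lborel)"
    using wd by (simp_all add: renyi_well_defined_def flip: moments)
  note hoelder = log_Hoelder[OF \<alpha> lden_nonneg lden_nonneg int pos]
  show "0 \<le> renyi \<alpha> P Q"
    using hoelder(1) \<alpha> by (simp add: renyi_eq_scaled_gap moments)
  assume "renyi \<alpha> P Q = 0"
  then have ratio: "AE x in lborel. lden P x powr (1 + \<alpha>) / (\<integral>x. lden P x powr (1 + \<alpha>) \<partial>lborel)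
      = lden Q x powr (1 + \<alpha>) / (\<integral>x. lden Q x powr (1 + \<alpha>) \<partial>lborel)"
    using hoelder(2) \<alpha> by (simp add: renyi_eq_scaled_gap moments)
  have "AE x in lborel. lden P x = lden Q x"
    by (rule proportional_powers_imp_eq_AE[OF _ pos(1,2) _ _ _ _ lden_mass(2)[OF P] lden_mass(2)[OF Q] ratio])
      (use \<alpha> in auto)
  then have "density lborel (\<lambda>x. ennreal (lden P x)) = density lborel (\<lambda>x. ennreal (lden Q x))"
    by (intro density_cong) auto
  then show "P = Q"
    by (simp add: density_lden P Q)
qed

lemma renyi_well_definedI:
  fixes P Q :: "'a::euclidean_space measure"
  assumes P: "borel_prob P" "has_lebesgue_density P" and Q: "borel_prob Q" "has_lebesgue_density Q"
    and \<alpha>: "0 < \<alpha>" "\<alpha> < \<beta>"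
    and PP: "integrable P (\<lambda>x. lden P x powr \<beta>)" and QQ: "integrable Q (\<lambda>x. lden Q x powr \<beta>)"
    and PQ: "integrable Q (\<lambda>x. lden P x powr \<beta>)" and pos: "AE x in Q. 0 < lden P x"
  shows "renyi_well_defined \<alpha> P Q"
proof -
  have moment: "integrable M (\<lambda>x. f x powr \<alpha>) \<and> 0 < (\<integral>x. f x powr \<alpha> \<partial>M)"
    if M: "borel_prob M" "has_lebesgue_density M" and f: "f \<in> borel_measurable borel"
      "integrable M (\<lambda>x. f x powr \<beta>)" "AE x in M. 0 < f x" for M :: "'a measure" and f
  proof -
    interpret M: prob_space M
      using M by (simp add: borel_prob_def)
    have int: "integrable M (\<lambda>x. f x powr \<alpha>)"
      by (rule M.integrable_powr_smaller[OF _ f(2) \<alpha>]) (simp add: M f(1))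
    have "AE x in M. 0 < f x powr \<alpha>"
      using f(3) by eventually_elim simp
    with int show ?thesis
      using M.integral_pos_AE[OF int] by simp
  qed
  show ?thesis
    unfolding renyi_well_defined_def L1_def mem_Collect_eq
    using moment[OF P borel_measurable_lden PP AE_lden_pos[OF P]]
      moment[OF Q borel_measurable_lden QQ AE_lden_pos[OF Q]]
      moment[OF Q borel_measurable_lden PQ pos]
    by (intro conjI) simp_all
qed

lemma tendsto_renyi_zero:
  fixes P Q :: "'a::euclidean_space measure"
  assumes P: "borel_prob P" "has_lebesgue_density P" and Q: "borel_prob Q" "has_lebesgue_density Q"
    and \<beta>: "0 < \<beta>"
    and PP: "integrable P (\<lambda>x. lden P x powr \<beta>)" "ln_in_L1 P (lden P)"
    and QQ: "integrable Q (\<lambda>x. lden Q x powr \<beta>)" "ln_in_L1 Q (lden Q)"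
    and PQ: "integrable Q (\<lambda>x. lden P x powr \<beta>)" "ln_in_L1 Q (lden P)"
  shows "((\<lambda>\<alpha>. renyi \<alpha> P Q) \<longlongrightarrow> renyi_zero P Q) (at_right 0)"
proof -
  have p: "prob_space P" and q: "prob_space Q"
    using P Q by (auto simp: borel_prob_def)
  have id: "((\<lambda>\<alpha>::real. \<alpha>) \<longlongrightarrow> 0) (at_right 0)"
    by (rule tendsto_ident_at)
  have lim_P: "((\<lambda>\<alpha>. ln (\<integral>x. lden P x powr \<alpha> \<partial>P)) \<longlongrightarrow> 0) (at_right 0)"
    using prob_space.tendsto_ln_moment(2)[OF p _ _ _ \<beta> PP(1)] PP(2) P by (simp add: ln_in_L1_def L1_def)
  have lim_Q: "((\<lambda>\<alpha>. ln (\<integral>x. lden Q x powr \<alpha> \<partial>Q) / \<alpha>) \<longlongrightarrow> (\<integral>x. ln (lden Q x) \<partial>Q)) (at_right 0)"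
    using prob_space.tendsto_ln_moment(1)[OF q _ _ _ \<beta> QQ(1)] QQ(2) Q by (simp add: ln_in_L1_def L1_def)
  have lim_PQ: "((\<lambda>\<alpha>. ln (\<integral>x. lden P x powr \<alpha> \<partial>Q) / \<alpha>) \<longlongrightarrow> (\<integral>x. ln (lden P x) \<partial>Q)) (at_right 0)"
    using prob_space.tendsto_ln_moment(1)[OF q _ _ _ \<beta> PQ(1)] PQ(2) Q by (simp add: ln_in_L1_def L1_def)
  have "((\<lambda>\<alpha>. 1 / (1 + \<alpha>) * ln (\<integral>x. lden P x powr \<alpha> \<partial>P)
        + 1 / (1 + \<alpha>) * (ln (\<integral>x. lden Q x powr \<alpha> \<partial>Q) / \<alpha>)
        - ln (\<integral>x. lden P x powr \<alpha> \<partial>Q) / \<alpha>)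
      \<longlongrightarrow> 1 / (1 + 0) * 0 + 1 / (1 + 0) * (\<integral>x. ln (lden Q x) \<partial>Q) - (\<integral>x. ln (lden P x) \<partial>Q)) (at_right 0)"
    by (intro tendsto_intros lim_P lim_Q lim_PQ id) auto
  then show ?thesis
    by (simp add: renyi_def renyi_zero_def mult.commute)
qed

theorem theorem2:
  fixes \<Theta> :: "(real ^ 'm) set"
    and P :: "real ^ 'm \<Rightarrow> (real ^ 'd) measure"
    and P0 Pplus :: "(real ^ 'd) measure set"
    and \<beta> :: real
  assumes family: "parametric_family \<Theta> P"
    and P0: "\<And>Q. Q \<in> P0 \<Longrightarrow> borel_prob Q \<and> has_lebesgue_density Q"
    and Pplus: "Pplus = P ` \<Theta> \<union> P0"
    and beta: "0 < \<beta>"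
    and p_beta: "\<And>\<theta> Q. \<theta> \<in> \<Theta> \<Longrightarrow> Q \<in> Pplus \<Longrightarrow> (\<lambda>x. lden (P \<theta>) x powr \<beta>) \<in> L1 Q"
    and q_beta: "\<And>Q. Q \<in> Pplus \<Longrightarrow> (\<lambda>x. lden Q x powr \<beta>) \<in> L1 Q"
    and ln_p: "\<And>\<theta> Q. \<theta> \<in> \<Theta> \<Longrightarrow> Q \<in> Pplus \<Longrightarrow> ln_in_L1 Q (lden (P \<theta>))"
  shows "(\<forall>\<alpha>. 0 < \<alpha> \<and> \<alpha> < \<beta> \<longrightarrow>
            (\<forall>\<theta>\<in>\<Theta>. \<forall>Q\<in>Pplus. renyi_well_defined \<alpha> (P \<theta>) Q) \<and>
            pseudodistance \<Theta> P Pplus (renyi \<alpha>) \<and>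
            (\<forall>\<theta>\<in>\<Theta>. \<forall>Q\<in>Pplus.
               renyi \<alpha> (P \<theta>) Q =
                 renyi_part0 \<alpha> (P \<theta>) + renyi_part1 \<alpha> Q
                 - 1 / \<alpha> * ln (\<integral>x. lden (P \<theta>) x powr \<alpha> \<partial>Q))) \<and>
         (\<forall>\<theta>\<in>\<Theta>. \<forall>Q\<in>Pplus.
            renyi_zero_well_defined (P \<theta>) Q \<and>
            ((\<lambda>\<alpha>. renyi \<alpha> (P \<theta>) Q) \<longlongrightarrow> renyi_zero (P \<theta>) Q) (at_right 0))"
proof -
  have reg: "borel_prob (P \<theta>)" "has_lebesgue_density (P \<theta>)" and inPplus: "P \<theta> \<in> Pplus" if "\<theta> \<in> \<Theta>" for \<theta>
    using family that by (auto simp: parametric_family_def Pplus)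
  have regQ: "borel_prob Q" "has_lebesgue_density Q" if "Q \<in> Pplus" for Q
    using that P0 reg by (auto simp: Pplus)
  have ident: "\<theta> = \<theta>'" if "\<theta> \<in> \<Theta>" "\<theta>' \<in> \<Theta>" "P \<theta> = P \<theta>'" for \<theta> \<theta>'
    using family that by (auto simp: parametric_family_def)
  have int_q: "integrable Q (\<lambda>x. lden Q x powr \<beta>)" if "Q \<in> Pplus" for Q
    using q_beta[OF that] by (simp add: L1_def)
  have int_p: "integrable Q (\<lambda>x. lden (P \<theta>) x powr \<beta>)" if "\<theta> \<in> \<Theta>" "Q \<in> Pplus" for \<theta> Q
    using p_beta[OF that] by (simp add: L1_def)
  have ln_q: "ln_in_L1 Q (lden Q)" if "\<theta> \<in> \<Theta>" "Q \<in> Pplus" for \<theta> Q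
    using ln_lden_integrable[OF regQ[OF that(2)], of "lden (P \<theta>)" \<beta>] lden_mass(1)[OF reg[OF that(1)]]
      ln_p[OF that] beta int_q[OF that(2)] AE_lden_pos[OF regQ[OF that(2)]]
    by (simp add: ln_in_L1_def L1_def)
  have wd: "renyi_well_defined \<alpha> (P \<theta>) Q" if "0 < \<alpha>" "\<alpha> < \<beta>" "\<theta> \<in> \<Theta>" "Q \<in> Pplus" for \<alpha> \<theta> Q
    using that ln_p[of \<theta> Q]
    by (intro renyi_well_definedI[of _ _ _ \<beta>] reg regQ int_p int_q inPplus) (auto simp: ln_in_L1_def)
  have pseudo: "pseudodistance \<Theta> P Pplus (renyi \<alpha>)" if \<alpha>: "0 < \<alpha>" "\<alpha> < \<beta>" for \<alpha>
    unfolding pseudodistance_def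
  proof (intro conjI ballI)
    show "0 \<le> renyi \<alpha> (P \<theta>) Q" if "\<theta> \<in> \<Theta>" "Q \<in> Pplus" for \<theta> Q
      by (intro renyi_nonneg_and_definite(1) reg regQ wd that \<alpha>)
    show "renyi \<alpha> (P \<theta>) (P \<theta>') = 0 \<longleftrightarrow> \<theta> = \<theta>'" if "\<theta> \<in> \<Theta>" "\<theta>' \<in> \<Theta>" for \<theta> \<theta>'
      using renyi_nonneg_and_definite(2)[OF reg[OF that(1)] reg[OF that(2)] \<alpha>(1) wd[OF \<alpha> that(1) inPplus[OF that(2)]]]
        ident[OF that] renyi_self[OF \<alpha>(1)] by auto
  qed
  have limit: "((\<lambda>\<alpha>. renyi \<alpha> (P \<theta>) Q) \<longlongrightarrow> renyi_zero (P \<theta>) Q) (at_right 0)"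
    if "\<theta> \<in> \<Theta>" "Q \<in> Pplus" for \<theta> Q
    by (rule tendsto_renyi_zero[OF reg[OF that(1)] regQ[OF that(2)] beta])
      (use that in \<open>auto intro: int_p int_q ln_p ln_q inPplus\<close>)
  show ?thesis
    using wd pseudo limit ln_q ln_p
    by (auto simp: renyi_zero_well_defined_def renyi_def renyi_part0_def renyi_part1_def)
qed

end
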